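(* Let $(X,d)$ be a CAT$(0)$ space that is totally bounded with modulus of total boundedness $\gamma:\mathbb{N}\to\mathbb{N}$. Let $T_1,T_2:X\to X$ satisfy property $(P_2)$ with $\mathrm{Fix}(S)\neq\emptyset$, where $S:=T_2\circ T_1$. Let $(\varepsilon_n),(\delta_n)$ be sequences of nonnegative reals with $\sum_{n=0}^\infty\varepsilon_n<\infty$ and $\sum_{n=0}^\infty\delta_n<\infty$, and put $\gamma_n:=\varepsilon_n+\delta_n$. Let $x_0\in X$ and let $(x_n),(y_n)$ be sequences in $X$ (with $(x_n)$ starting at $x_0$) satisfying $$d(y_n,T_1x_n)\le\varepsilon_n\quad\text{and}\quad d(x_{n+1},T_2y_n)\le\delta_n\qquad\text{for each } n\in\mathbb{N}.$$ Let $\alpha:(0,\infty)\to\mathbb{N}$ be a Cauchy modulus for $\sum_{n=0}^\infty\gamma_n$, let $\beta:(0,\infty)\to\mathbb{N}$ be a rate of convergence for $\gamma_n\to0$, let $B\ge0$ be such that $\sum_{n\ge0}\gamma_n\le B$, and let $b>0$ be such that there exists $u\in\mathrm{Fix}(S)$ with $d(x_0,u)\le b$. Then $(x_n)$ is Cauchy with rate of metastability $\widehat\Psi$, i.e., for all $k\in\mathbb{N}$ and all $g:\mathbb{N}\to\mathbb{N}$, $$\exists n\le\widehat\Psi(k,g,\gamma,\alpha,\beta,b,B)\ \forall i,j\in[n,n+g(n)]\ \Bigl(d(x_i,x_j)\le\frac1{k+1}\Bigr),$$ where $\widehat\Psi(k,g,\gamma,\alpha,\beta,b,B):=\widehat\Psi_0(P)$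 with $$P:=\gamma(8k+7)+1,\qquad \xi(m):=\alpha(1/(m+1)),\qquad \chi^M_g(n,m):=\bigl(\max_{i\le n}g(i)\bigr)\cdot(m+1),$$ and $\widehat\Psi_0$ is defined recursively by $$\widehat\Psi_0(0):=0,\qquad \widehat\Psi_0(n+1):=\widehat\Phi_\beta\bigl(\chi^M_g(\widehat\Psi_0(n),8k+7),\,\xi(8k+7)\bigr).$$ Analogously for $(y_n)$: put $\gamma'_n:=\varepsilon_{n+1}+\delta_n$, let $\beta':(0,\infty)\to\mathbb{N}$ be a rate of convergence for $\gamma'_n\to0$ and $\alpha':(0,\infty)\to\mathbb{N}$ a Cauchy modulus for $\sum_{n=0}^\infty\gamma'_n$. Then for all $k\in\mathbb{N}$ and $g:\mathbb{N}\to\mathbb{N}$, $$\exists n\le\widehat\Psi'_0(P)\ \forall i,j\in[n,n+g(n)]\ \Bigl(d(y_i,y_j)\le\frac1{k+1}\Bigr),$$ where $P$ and $\chi^M_g$ are as defined for $(x_n)$, $\xi'(m):=\alpha'(1/(m+1))$, $\widehat\Psi'_0(0):=0$ and $\widehat\Psi'_0(n+1):=\widehat\Phi'_{\beta'}\bigl(\chi^M_g(\widehat\Psi'_0(n),8k+7),\,\xi'(8k+7)\bigr)$. The functions $\widehat\Phi_\beta$ and $\widehat\Phi'_{\beta'}$ are those defined explicitly in the context.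
   Context: $\mathbb{N}=\{0,1,2,\dots\}$; intervals $[n,n+g(n)]$ are intervals of natural numbers. A CAT$(0)$ space is a geodesic metric space $(X,d)$ (any two points are joined by a geodesic path) satisfying, for all $x,y,u,v\in X$, $d(x,y)^2+d(u,v)^2\le d(x,v)^2+d(y,u)^2+2d(x,u)d(y,v)$ (this is equivalent to the usual definition). A mapping $T:X\to X$ satisfies property $(P_2)$ if $2d(Tx,Ty)^2\le d(x,Ty)^2+d(y,Tx)^2-d(x,Tx)^2-d(y,Ty)^2$ for all $x,y\in X$. $\mathrm{Fix}(S)=\{x\in X: Sx=x\}$. A function $\gamma:\mathbb{N}\to\mathbb{N}$ is a modulus of total boundedness for $X$ if for every $k\in\mathbb{N}$ and every sequence $(a_n)$ in $X$ there exist $0\le i<j\le\gamma(k)$ with $d(a_i,a_j)\le\frac1{k+1}$. (The function $\gamma$ is not to be confused with the error terms $\gamma_n$.) A Cauchy modulus for a series $\sum_{n=0}^\infty c_n$ of nonnegative reals is $\alpha:(0,\infty)\to\mathbb{N}$ with $\sum_{i=\alpha(\varepsilon)}^{\alpha(\varepsilon)+k}c_i\le\varepsilon$ for all $\varepsilon>0$, $k\in\mathbb{N}$. A rate of convergence for $c_n\to0$ ($c_n\ge0$) is $\beta:(0,\infty)\to\mathbb{N}$ with $c_n\le\varepsilon$ for all $\varepsilon>0$ and $n\ge\beta(\varepsilon)$. Define, for $\eta,c>0$, $\Phi(\eta,c):=K\left\lceil\frac{2c(1+2^K)}{\eta}\right\rceil+1$ with $K:=\left\lceil\frac{2c}{\eta}\right\rceil$.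 For $\varepsilon>0$ define $\Phi'(\varepsilon):=\alpha(\varepsilon/3)+\Phi(\varepsilon/3,2(b+B))$, $\Phi''(\varepsilon):=\Phi'(\varepsilon/2)$, $\Phi_\beta(\varepsilon):=\max\{\beta(\varepsilon/2),\Phi'(\varepsilon/2)\}$, $\Phi'_{\beta'}(\varepsilon):=\max\{\beta'(\varepsilon/2),\Phi''(\varepsilon/2)\}$. For $k,N\in\mathbb{N}$ define $\widehat\Phi_\beta(k,N):=\max\{N,\max\{\Phi_\beta(1/(i+1)):i\le k\}\}$ and $\widehat\Phi'_{\beta'}(k,N):=\max\{N,\max\{\Phi'_{\beta'}(1/(i+1)):i\le k\}\}$. *)

theory Defs
  imports "HOL-Analysis.Analysis"
begin

definition geodesic_path ::
  "'a set \<Rightarrow> ('a \<Rightarrow> 'a \<Rightarrow> real) \<Rightarrow> real \<Rightarrow> (real \<Rightarrow> 'a) \<Rightarrow> 'a \<Rightarrow> 'a \<Rightarrow> bool" where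
  "geodesic_path X d l c x y \<longleftrightarrow>
     0 \<le> l \<and> c ` {0..l} \<subseteq> X \<and> c 0 = x \<and> c l = y \<and>
     (\<forall>s\<in>{0..l}. \<forall>t\<in>{0..l}. d (c s) (c t) = \<bar>s - t\<bar>)"

text \<open>CAT(0) spaces, by way of the quadrilateral (Berg--Nikolaev) inequality.\<close>

locale CAT0_space = Metric_space X d
  for X :: "'a set" and d :: "'a \<Rightarrow> 'a \<Rightarrow> real" +
  assumes geodesic: "\<lbrakk>x \<in> X; y \<in> X\<rbrakk> \<Longrightarrow> \<exists>l c. geodesic_path X d l c x y"
    and quadrilateral: "\<lbrakk>x \<in> X; y \<in> X; u \<in> X; v \<in> X\<rbrakk> \<Longrightarrow>
      (d x y)\<^sup>2 + (d u v)\<^sup>2 \<le> (d x v)\<^sup>2 + (d y u)\<^sup>2 + 2 * d x u * d y v"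

definition property_P2 :: "'a set \<Rightarrow> ('a \<Rightarrow> 'a \<Rightarrow> real) \<Rightarrow> ('a \<Rightarrow> 'a) \<Rightarrow> bool" where
  "property_P2 X d T \<longleftrightarrow> (\<forall>x\<in>X. \<forall>y\<in>X.
     2 * (d (T x) (T y))\<^sup>2 \<le>
       (d x (T y))\<^sup>2 + (d y (T x))\<^sup>2 - (d x (T x))\<^sup>2 - (d y (T y))\<^sup>2)"

definition Fix :: "'a set \<Rightarrow> ('a \<Rightarrow> 'a) \<Rightarrow> 'a set" where
  "Fix X S = {x \<in> X. S x = x}"

definition total_boundedness_modulus ::
  "'a set \<Rightarrow> ('a \<Rightarrow> 'a \<Rightarrow> real) \<Rightarrow> (nat \<Rightarrow> nat) \<Rightarrow> bool" where
  "total_boundedness_modulus X d \<gamma> \<longleftrightarrow>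
     (\<forall>k. \<forall>a::nat \<Rightarrow> 'a. (\<forall>n. a n \<in> X) \<longrightarrow>
        (\<exists>i j. i < j \<and> j \<le> \<gamma> k \<and> d (a i) (a j) \<le> 1 / (real k + 1)))"

text \<open>Moduli defined on the positive reals are total functions \<^typ>\<open>real \<Rightarrow> nat\<close>
  about which nothing is assumed at nonpositive arguments.\<close>

definition Cauchy_modulus :: "(nat \<Rightarrow> real) \<Rightarrow> (real \<Rightarrow> nat) \<Rightarrow> bool" where
  "Cauchy_modulus c \<alpha> \<longleftrightarrow> (\<forall>\<epsilon>>0. \<forall>k. (\<Sum>i = \<alpha> \<epsilon>..\<alpha> \<epsilon> + k. c i) \<le> \<epsilon>)"

definition null_convergence_rate :: "(nat \<Rightarrow> real) \<Rightarrow> (real \<Rightarrow> nat) \<Rightarrow> bool" where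
  "null_convergence_rate c \<beta> \<longleftrightarrow> (\<forall>\<epsilon>>0. \<forall>n\<ge>\<beta> \<epsilon>. c n \<le> \<epsilon>)"

definition metastability_rate ::
  "('a \<Rightarrow> 'a \<Rightarrow> real) \<Rightarrow> (nat \<Rightarrow> 'a) \<Rightarrow> (nat \<Rightarrow> (nat \<Rightarrow> nat) \<Rightarrow> nat) \<Rightarrow> bool" where
  "metastability_rate d x \<Omega> \<longleftrightarrow>
     (\<forall>k g. \<exists>n\<le>\<Omega> k g. \<forall>i\<in>{n..n + g n}. \<forall>j\<in>{n..n + g n}.
        d (x i) (x j) \<le> 1 / (real k + 1))"

definition Phi :: "real \<Rightarrow> real \<Rightarrow> nat" where
  "Phi \<eta> c = (let K = nat \<lceil>2 * c / \<eta>\<rceil>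
              in K * nat \<lceil>2 * c * (1 + 2 ^ K) / \<eta>\<rceil> + 1)"

definition Phi' :: "(real \<Rightarrow> nat) \<Rightarrow> real \<Rightarrow> real \<Rightarrow> real \<Rightarrow> nat" where
  "Phi' \<alpha> b B \<epsilon> = \<alpha> (\<epsilon> / 3) + Phi (\<epsilon> / 3) (2 * (b + B))"

definition Phi'' :: "(real \<Rightarrow> nat) \<Rightarrow> real \<Rightarrow> real \<Rightarrow> real \<Rightarrow> nat" where
  "Phi'' \<alpha> b B \<epsilon> = Phi' \<alpha> b B (\<epsilon> / 2)"

definition Phi_beta ::
  "(real \<Rightarrow> nat) \<Rightarrow> (real \<Rightarrow> nat) \<Rightarrow> real \<Rightarrow> real \<Rightarrow> real \<Rightarrow> nat" where
  "Phi_beta \<alpha> \<beta> b B \<epsilon> = max (\<beta> (\<epsilon> / 2)) (Phi' \<alpha> b B (\<epsilon> / 2))"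

definition Phi'_beta ::
  "(real \<Rightarrow> nat) \<Rightarrow> (real \<Rightarrow> nat) \<Rightarrow> real \<Rightarrow> real \<Rightarrow> real \<Rightarrow> nat" where
  "Phi'_beta \<alpha> \<beta>' b B \<epsilon> = max (\<beta>' (\<epsilon> / 2)) (Phi'' \<alpha> b B (\<epsilon> / 2))"

definition Phi_hat ::
  "(real \<Rightarrow> nat) \<Rightarrow> (real \<Rightarrow> nat) \<Rightarrow> real \<Rightarrow> real \<Rightarrow> nat \<Rightarrow> nat \<Rightarrow> nat" where
  "Phi_hat \<alpha> \<beta> b B k N =
     max N (Max ((\<lambda>i. Phi_beta \<alpha> \<beta> b B (1 / (real i + 1))) ` {..k}))"

definition Phi'_hat ::
  "(real \<Rightarrow> nat) \<Rightarrow> (real \<Rightarrow> nat) \<Rightarrow> real \<Rightarrow> real \<Rightarrow> nat \<Rightarrow> nat \<Rightarrow> nat" where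
  "Phi'_hat \<alpha> \<beta>' b B k N =
     max N (Max ((\<lambda>i. Phi'_beta \<alpha> \<beta>' b B (1 / (real i + 1))) ` {..k}))"

definition chi_M :: "(nat \<Rightarrow> nat) \<Rightarrow> nat \<Rightarrow> nat \<Rightarrow> nat" where
  "chi_M g n m = Max (g ` {..n}) * (m + 1)"

definition xi :: "(real \<Rightarrow> nat) \<Rightarrow> nat \<Rightarrow> nat" where
  "xi \<alpha> m = \<alpha> (1 / (real m + 1))"

primrec Psi0 ::
  "nat \<Rightarrow> (nat \<Rightarrow> nat) \<Rightarrow> (real \<Rightarrow> nat) \<Rightarrow> (real \<Rightarrow> nat) \<Rightarrow> real \<Rightarrow> real \<Rightarrow> nat \<Rightarrow> nat" where
  "Psi0 k g \<alpha> \<beta> b B 0 = 0"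
| "Psi0 k g \<alpha> \<beta> b B (Suc n) =
     Phi_hat \<alpha> \<beta> b B (chi_M g (Psi0 k g \<alpha> \<beta> b B n) (8 * k + 7)) (xi \<alpha> (8 * k + 7))"

text \<open>Here \<open>\<alpha>\<close> belongs to the error terms of the first sequence (it enters through
  \<^const>\<open>Phi''\<close>), and \<open>\<alpha>'\<close>, \<open>\<beta>'\<close> to those of the second.\<close>

primrec Psi0' ::
  "nat \<Rightarrow> (nat \<Rightarrow> nat) \<Rightarrow> (real \<Rightarrow> nat) \<Rightarrow> (real \<Rightarrow> nat) \<Rightarrow> (real \<Rightarrow> nat) \<Rightarrow> real \<Rightarrow> real \<Rightarrow> nat \<Rightarrow> nat"
where
  "Psi0' k g \<alpha> \<alpha>' \<beta>' b B 0 = 0"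
| "Psi0' k g \<alpha> \<alpha>' \<beta>' b B (Suc n) =
     Phi'_hat \<alpha> \<beta>' b B (chi_M g (Psi0' k g \<alpha> \<alpha>' \<beta>' b B n) (8 * k + 7)) (xi \<alpha>' (8 * k + 7))"

definition Psi ::
  "nat \<Rightarrow> (nat \<Rightarrow> nat) \<Rightarrow> (nat \<Rightarrow> nat) \<Rightarrow> (real \<Rightarrow> nat) \<Rightarrow> (real \<Rightarrow> nat) \<Rightarrow> real \<Rightarrow> real \<Rightarrow> nat" where
  "Psi k g \<gamma> \<alpha> \<beta> b B = Psi0 k g \<alpha> \<beta> b B (\<gamma> (8 * k + 7) + 1)"

definition Psi' ::
  "nat \<Rightarrow> (nat \<Rightarrow> nat) \<Rightarrow> (nat \<Rightarrow> nat) \<Rightarrow> (real \<Rightarrow> nat) \<Rightarrow> (real \<Rightarrow> nat) \<Rightarrow> (real \<Rightarrow> nat) \<Rightarrow>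
     real \<Rightarrow> real \<Rightarrow> nat" where
  "Psi' k g \<gamma> \<alpha> \<alpha>' \<beta>' b B = Psi0' k g \<alpha> \<alpha>' \<beta>' b B (\<gamma> (8 * k + 7) + 1)"

end

theory Submission
  imports Defs
begin

text \<open>
  Why the theorem holds. A mapping with property \<open>(P\<^sub>2)\<close> on a CAT(0) space is nonexpansive.
  The heart of the matter is that the composition \<open>S = T2 \<circ> T1\<close> of two such mappings
  satisfies, besides nonexpansiveness, the linear inequality
  \<open>2 d(S u, S w) \<le> d(u, S w) + d(w, S u)\<close>
  (\<open>P2_composition_midpoint\<close>): adding the two instances of \<open>(P\<^sub>2)\<close> to two instances of the
  quadrilateral inequality makes all squared step lengths \<open>d(u, T1 u)\<close>, \<open>d(T1 u, S u)\<close> cancel.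

  Along an orbit of \<open>S\<close> this says that the distances \<open>A j n = d(S\<^sup>n u, S\<^sup>n\<^sup>+\<^sup>j u)\<close> are convex in
  \<open>j\<close>, up to the amount by which they still decrease in \<open>n\<close>. If \<open>A 1\<close> stayed above \<open>\<eta>\<close>, then on
  every window of \<open>K\<close> consecutive times either some \<open>A i\<close> would drop noticeably or \<open>A K\<close> would be
  close to \<open>K \<eta>\<close>, which the bound on the orbit forbids. As each \<open>A i\<close> is nonincreasing and bounded,
  it can drop only finitely often; counting windows yields the rate \<open>Phi\<close>
  (\<open>rate_from_almost_convexity\<close>).

  The inexact iterations \<open>x\<close> and \<open>y\<close> follow orbits of \<open>T2 \<circ> T1\<close> and \<open>T1 \<circ> T2\<close> up to summable
  errors. The rate transfers to \<open>d(x\<^sub>n, S x\<^sub>n)\<close> by restarting an exact orbit at a time after which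
  the errors are negligible, and the distances to an approximate fixed point \<open>p\<close> of \<open>S\<close> grow by at
  most \<open>d(p, S p)\<close> plus the error in every step. Late members of the sequence are good
  approximate fixed points, and by total boundedness one of them is close to an earlier member
  \<open>x\<^sub>n\<close>; it then stays close to \<open>x\<^sub>n, \<dots>, x\<^sub>n\<^sub>+\<^sub>g\<^sub>(\<^sub>n\<^sub>)\<close>, which is metastability
  (\<open>metastability_of_regular_sequence\<close>).
\<close>

section \<open>Compositions of mappings with property (P2)\<close>

text \<open>In the quadrilateral \<open>u, w, T w, T u\<close>, the right-hand side of \<open>(P\<^sub>2)\<close> is the sum of the
  squared diagonals minus the squares of the opposite sides \<open>u, T u\<close> and \<open>w, T w\<close>; it is at most
  \<open>2 d(u, w) d(T u, T w)\<close>.\<close>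

lemma (in CAT0_space) P2_nonexpansive:
  assumes P2: "property_P2 X d T" and T: "T \<in> X \<rightarrow> X" and u: "u \<in> X" and w: "w \<in> X"
  shows "d (T u) (T w) \<le> d u w"
proof -
  have TX: "T u \<in> X" "T w \<in> X" using T u w by auto
  have "2 * (d (T u) (T w))\<^sup>2
      \<le> (d u (T w))\<^sup>2 + (d w (T u))\<^sup>2 - (d u (T u))\<^sup>2 - (d w (T w))\<^sup>2"
    using P2 u w by (auto simp: property_P2_def)
  moreover have "(d u (T w))\<^sup>2 + (d w (T u))\<^sup>2
      \<le> (d u (T u))\<^sup>2 + (d w (T w))\<^sup>2 + 2 * d u w * d (T u) (T w)"
    using quadrilateral[of u "T w" w "T u"] u w TX by (simp add: commute)
  ultimately have "d (T u) (T w) * d (T u) (T w) \<le> d u w * d (T u) (T w)"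
    by (simp add: power2_eq_square)
  then have "0 < d (T u) (T w) \<Longrightarrow> d (T u) (T w) \<le> d u w"
    by (simp add: mult_le_cancel_right)
  then show ?thesis using nonneg[of u w] by linarith
qed

text \<open>With \<open>p = d(T1 u, T1 w)\<close> and \<open>q = d(S u, S w)\<close>, the two instances of \<open>(P\<^sub>2)\<close> and the
  quadrilateral inequalities for \<open>u, T1 u, T1 w, S w\<close> and \<open>w, T1 w, T1 u, S u\<close>
  add up to \<open>p\<^sup>2 + q\<^sup>2 \<le> p (d(u, S w) + d(w, S u))\<close>, and \<open>p\<^sup>2 + q\<^sup>2 \<ge> 2 p q\<close>.\<close>

lemma (in CAT0_space) P2_composition_midpoint:
  assumes P2: "property_P2 X d T1" "property_P2 X d T2"
    and T1: "T1 \<in> X \<rightarrow> X" and T2: "T2 \<in> X \<rightarrow> X" and u: "u \<in> X" and w: "w \<in> X"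
  shows "2 * d (T2 (T1 u)) (T2 (T1 w)) \<le> d u (T2 (T1 w)) + d w (T2 (T1 u))"
proof -
  define u1 w1 u2 w2 where defs: "u1 = T1 u" "w1 = T1 w" "u2 = T2 u1" "w2 = T2 w1"
  have X: "u1 \<in> X" "w1 \<in> X" "u2 \<in> X" "w2 \<in> X"
    using T1 T2 u w by (auto simp: defs)
  have 1: "2 * (d u1 w1)\<^sup>2 \<le> (d u w1)\<^sup>2 + (d w u1)\<^sup>2 - (d u u1)\<^sup>2 - (d w w1)\<^sup>2"
    using P2(1) u w unfolding property_P2_def defs by blast
  have 2: "2 * (d u2 w2)\<^sup>2 \<le> (d u1 w2)\<^sup>2 + (d w1 u2)\<^sup>2 - (d u1 u2)\<^sup>2 - (d w1 w2)\<^sup>2"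
    using P2(2) X(1,2) unfolding property_P2_def defs by blast
  have 3: "(d u w1)\<^sup>2 + (d u1 w2)\<^sup>2 \<le> (d u u1)\<^sup>2 + (d w1 w2)\<^sup>2 + 2 * d u w2 * d u1 w1"
    using quadrilateral[of u w1 w2 u1] u X by (simp add: commute)
  have 4: "(d w u1)\<^sup>2 + (d w1 u2)\<^sup>2 \<le> (d w w1)\<^sup>2 + (d u1 u2)\<^sup>2 + 2 * d w u2 * d u1 w1"
    using quadrilateral[of w u1 u2 w1] w X by (simp add: commute)
  have main: "(d u1 w1)\<^sup>2 + (d u2 w2)\<^sup>2 \<le> (d u w2 + d w u2) * d u1 w1"
    using 1 2 3 4 by (simp add: algebra_simps)
  have "2 * d u2 w2 \<le> d u w2 + d w u2"
  proof (cases "d u1 w1 = 0")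
    case True
    then have "d u2 w2 = 0" using main by simp
    then show ?thesis by simp
  next
    case False
    then have pos: "0 < d u1 w1" using nonneg[of u1 w1] by linarith
    have "2 * d u2 w2 * d u1 w1 \<le> (d u1 w1)\<^sup>2 + (d u2 w2)\<^sup>2"
      using sum_squares_bound[of "d u1 w1" "d u2 w2"] by (simp add: mult.commute mult.left_commute)
    then have "2 * d u2 w2 * d u1 w1 \<le> (d u w2 + d w u2) * d u1 w1" using main by linarith
    then show ?thesis using pos by (simp add: mult_le_cancel_right)
  qed
  then show ?thesis by (simp add: defs)
qed

section \<open>Asymptotic regularity\<close>

text \<open>For \<open>A\<close> constant in its second argument, the third assumption says that \<open>A\<close> is convex in
  the first, so that its increments are at least \<open>A 1\<close>. The sum is the price for
  advancing the second argument.\<close>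

lemma almost_convex_increment:
  fixes A :: "nat \<Rightarrow> nat \<Rightarrow> real"
  assumes zero: "\<And>n. A 0 n = 0"
    and dec: "\<And>j. antimono (A j)"
    and conv: "\<And>j n. 2 * A (Suc j) (Suc n) \<le> A (Suc (Suc j)) n + A j (Suc n)"
  shows "A 1 (n + j) - (\<Sum>i\<le>j. A i n - A i (n + j)) \<le> A (Suc j) n - A j n"
proof (induction j arbitrary: n)
  case 0
  then show ?case by (simp add: zero)
next
  case (Suc j)
  have "(\<Sum>i\<le>j. A i (Suc n) - A i (Suc n + j)) \<le> (\<Sum>i\<le>j. A i n - A i (n + Suc j))"
    by (rule sum_mono) (use antimonoD[OF dec, of n "Suc n"] in auto)
  moreover have "A (Suc j) (n + Suc j) \<le> A (Suc j) (Suc n)"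
    by (rule antimonoD[OF dec]) simp
  ultimately show ?case
    using Suc.IH[of "Suc n"] conv[of j n] by simp
qed

text \<open>Suppose \<open>A 1 > \<eta>\<close> up to time \<open>Phi \<eta> c\<close>, and put \<open>W n = (\<Sum>i<K. A i n)\<close>. Summing
  \<open>almost_convex_increment\<close> over \<open>j < K\<close> shows that a window of length \<open>K\<close> on which \<open>W\<close> loses less
  than \<open>\<eta> / 2\<close> forces \<open>A K > K \<eta> / 2 \<ge> c\<close>. So \<open>W\<close>, which is at most \<open>K c\<close>, loses \<open>\<eta> / 2\<close> on each
  of the \<open>N\<close> windows that fit into \<open>Phi \<eta> c = K N + 1\<close>, and \<open>N \<eta> / 2 \<ge> (1 + 2\<^sup>K) c\<close> is too much.\<close>

lemma rate_from_almost_convexity: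
  fixes A :: "nat \<Rightarrow> nat \<Rightarrow> real"
  assumes zero: "\<And>n. A 0 n = 0"
    and dec: "\<And>j. antimono (A j)"
    and conv: "\<And>j n. 2 * A (Suc j) (Suc n) \<le> A (Suc (Suc j)) n + A j (Suc n)"
    and nonneg: "\<And>j n. 0 \<le> A j n"
    and bound: "\<And>j n. A j n \<le> c"
    and eta: "0 < \<eta>"
    and n: "Phi \<eta> c \<le> n"
  shows "A 1 n \<le> \<eta>"
proof (rule ccontr)
  assume "\<not> A 1 n \<le> \<eta>"
  then have big: "\<eta> \<le> A 1 m" if "m \<le> Phi \<eta> c" for m
    using antimonoD[OF dec, of m n 1] that n by linarith
  have c: "0 < c" using big[of 0] bound[of 1 0] eta by linarith
  define K where "K = nat \<lceil>2 * c / \<eta>\<rceil>"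
  define N where "N = nat \<lceil>2 * c * (1 + 2 ^ K) / \<eta>\<rceil>"
  define W where "W = (\<lambda>m. \<Sum>i<K. A i m)"
  have Phi: "Phi \<eta> c = K * N + 1" by (simp add: Phi_def K_def N_def Let_def)
  have "2 * c / \<eta> \<le> real K" unfolding K_def by (rule real_nat_ceiling_ge)
  then have K: "2 * c \<le> real K * \<eta>" using eta by (simp add: field_simps)
  then have Kpos: "0 < K" using c by (cases "K = 0") auto
  have "2 * c * (1 + 2 ^ K) / \<eta> \<le> real N" unfolding N_def by (rule real_nat_ceiling_ge)
  then have N: "2 * c * (1 + 2 ^ K) \<le> real N * \<eta>" using eta by (simp add: field_simps)
  have loss: "\<eta> / 2 \<le> W m - W (m + K)" if m: "m + K \<le> Phi \<eta> c" for m
  proof -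
    have incr: "\<eta> - (W m - W (m + K)) \<le> A (Suc j) m - A j m" if j: "j < K" for j
    proof -
      have "(\<Sum>i\<le>j. A i m - A i (m + j)) \<le> (\<Sum>i\<le>j. A i m - A i (m + K))"
        by (rule sum_mono) (use antimonoD[OF dec, of "m + j" "m + K"] j in auto)
      also have "\<dots> \<le> (\<Sum>i<K. A i m - A i (m + K))"
        by (rule sum_mono2) (use antimonoD[OF dec, of m "m + K"] j in auto)
      also have "\<dots> = W m - W (m + K)" by (simp add: W_def sum_subtractf)
      finally show ?thesis
        using almost_convex_increment[of A m j] zero dec conv big[of "m + j"] j m by force
    qed
    have "real K * (\<eta> - (W m - W (m + K))) \<le> (\<Sum>j<K. A (Suc j) m - A j m)"
      using sum_mono[of "{..<K}" "\<lambda>_. \<eta> - (W m - W (m + K))" "\<lambda>j. A (Suc j) m - A j m"] incr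
      by simp
    also have "\<dots> = A K m" using sum_lessThan_telescope[of "\<lambda>j. A j m" K] by (simp add: zero)
    also have "\<dots> \<le> real K * (\<eta> / 2)" using bound[of K m] K by simp
    finally have "\<eta> - (W m - W (m + K)) \<le> \<eta> / 2" using Kpos by simp
    then show ?thesis by simp
  qed
  have "real t * (\<eta> / 2) \<le> W 0 - W (t * K)" if "t \<le> N" for t
    using that
  proof (induction t)
    case 0
    then show ?case by simp
  next
    case (Suc t)
    have "t * K + K \<le> N * K" using mult_le_mono1[OF Suc.prems, of K] by simp
    then have "\<eta> / 2 \<le> W (t * K) - W (t * K + K)"
      by (intro loss) (simp add: Phi mult.commute)
    then show ?case using Suc by (simp add: algebra_simps add_divide_distrib)
  qed
  from this[of N] have "real N * \<eta> \<le> 2 * W 0 - 2 * W (N * K)" by simp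
  moreover have "0 \<le> W (N * K)" unfolding W_def by (intro sum_nonneg) (simp add: nonneg)
  moreover have "W 0 \<le> real K * c"
    unfolding W_def using sum_bounded_above[of "{..<K}" "\<lambda>i. A i 0" c] bound by simp
  ultimately have "c * (1 + 2 ^ K) \<le> c * real K" using N by (simp add: algebra_simps)
  then have "1 + 2 ^ K \<le> real K" using c by simp
  moreover have "real K < 2 ^ K" by (rule of_nat_less_two_power)
  ultimately show False by linarith
qed

section \<open>Inexact iterations of a nonexpansive mapping\<close>

locale nonexpansive_mapping = Metric_space X d
  for X :: "'a set" and d :: "'a \<Rightarrow> 'a \<Rightarrow> real" +
  fixes S :: "'a \<Rightarrow> 'a"
  assumes S_closed: "S \<in> X \<rightarrow> X"
    and nonexpansive: "\<lbrakk>u \<in> X; w \<in> X\<rbrakk> \<Longrightarrow> d (S u) (S w) \<le> d u w"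
begin

lemma funpow_closed: "u \<in> X \<Longrightarrow> (S ^^ n) u \<in> X"
  using S_closed by (induction n) auto

text \<open>A fixed point \<open>u\<close> within \<open>r\<close> of the starting point keeps the whole orbit within \<open>r\<close> of \<open>u\<close>,
  so that \<open>2 r\<close> bounds all distances between members of the orbit.\<close>

lemma orbit_asymptotic_regularity:
  assumes mid: "\<And>u w. \<lbrakk>u \<in> X; w \<in> X\<rbrakk> \<Longrightarrow> 2 * d (S u) (S w) \<le> d u (S w) + d w (S u)"
    and u: "u \<in> Fix X S" and w: "w \<in> X" and r: "d w u \<le> r"
    and eta: "0 < \<eta>" and n: "Phi \<eta> (2 * r) \<le> n"
  shows "d ((S ^^ n) w) (S ((S ^^ n) w)) \<le> \<eta>"
proof -
  define A where "A = (\<lambda>j n. d ((S ^^ n) w) ((S ^^ (n + j)) w))"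
  have X: "(S ^^ n) w \<in> X" for n using w by (rule funpow_closed)
  have uX: "u \<in> X" and Su: "S u = u" using u by (auto simp: Fix_def)
  have near: "d ((S ^^ n) w) u \<le> r" for n
  proof (induction n)
    case (Suc n)
    then show ?case using nonexpansive[OF X[of n] uX] Su by simp
  qed (simp add: r)
  have "A 1 n \<le> \<eta>"
  proof (rule rate_from_almost_convexity[where A = A, OF _ _ _ _ _ eta n])
    show "A 0 n = 0" for n using X by (simp add: A_def)
    show "antimono (A j)" for j
      unfolding A_def by (intro decseq_SucI) (simp add: nonexpansive X)
    show "2 * A (Suc j) (Suc n) \<le> A (Suc (Suc j)) n + A j (Suc n)" for j n
      using mid[OF X[of n] X[of "Suc (n + j)"]] by (simp add: A_def commute)
    show "0 \<le> A j n" for j n by (simp add: A_def)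
    show "A j n \<le> 2 * r" for j n
      using triangle[OF X[of n] uX X[of "n + j"]] near[of n] near[of "n + j"]
      by (simp add: A_def commute)
  qed
  then show ?thesis by (simp add: A_def)
qed

end

lemma Cauchy_modulus_tail:
  assumes "Cauchy_modulus e \<alpha>" and "\<And>n. 0 \<le> e n" and "0 < \<eta>" and "\<alpha> \<eta> \<le> n"
  shows "(\<Sum>i<l. e (n + i)) \<le> \<eta>"
proof -
  have "(\<Sum>i<l. e (n + i)) = sum e {n..<n + l}"
    using sum.shift_bounds_nat_ivl[of e 0 n l] by (simp add: add.commute atLeast0LessThan)
  also have "\<dots> \<le> sum e {\<alpha> \<eta>..\<alpha> \<eta> + (n + l)}"
    by (rule sum_mono2) (use assms in auto)
  also have "\<dots> \<le> \<eta>" using assms by (simp add: Cauchy_modulus_def)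
  finally show ?thesis .
qed

locale inexact_iteration = nonexpansive_mapping X d S
  for X :: "'a set" and d :: "'a \<Rightarrow> 'a \<Rightarrow> real" and S :: "'a \<Rightarrow> 'a" +
  fixes x :: "nat \<Rightarrow> 'a" and e :: "nat \<Rightarrow> real"
  assumes x_closed: "x n \<in> X"
    and error: "d (x (Suc n)) (S (x n)) \<le> e n"
begin

lemma error_nonneg: "0 \<le> e n"
  using error[of n] nonneg[of "x (Suc n)" "S (x n)"] by linarith

text \<open>Each step applies \<open>S\<close>, moving \<open>p\<close> to \<open>S p\<close> without increasing the distance; returning from
  \<open>S p\<close> to \<open>p\<close> and the error of the iteration account for the additional terms.\<close>

lemma quasi_Fejer:
  assumes p: "p \<in> X"
  shows "d (x (n + l)) p \<le> d (x n) p + real l * d p (S p) + (\<Sum>i<l. e (n + i))"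
proof (induction l)
  case (Suc l)
  have SX: "S p \<in> X" "S (x (n + l)) \<in> X" using S_closed p x_closed by auto
  have "d (x (Suc (n + l))) p
      \<le> d (x (Suc (n + l))) (S (x (n + l))) + d (S (x (n + l))) (S p) + d (S p) p"
    using triangle[OF x_closed[of "Suc (n + l)"] SX(2) p] triangle[OF SX(2,1) p] by linarith
  also have "\<dots> \<le> e (n + l) + d (x (n + l)) p + d p (S p)"
    using error[of "n + l"] nonexpansive[OF x_closed[of "n + l"] p] by (simp add: commute)
  finally show ?case using Suc.IH by (simp add: algebra_simps)
qed simp

lemma distance_to_exact_orbit:
  "d (x (n + l)) ((S ^^ l) (x n)) \<le> (\<Sum>i<l. e (n + i))"
proof (induction l)
  case 0
  then show ?case using x_closed by simp
next
  case (Suc l)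
  have X: "(S ^^ l) (x n) \<in> X" "S (x (n + l)) \<in> X" "(S ^^ Suc l) (x n) \<in> X"
    using x_closed S_closed funpow_closed[of "x n"] by auto
  have "d (x (Suc (n + l))) ((S ^^ Suc l) (x n))
      \<le> d (x (Suc (n + l))) (S (x (n + l))) + d (S (x (n + l))) ((S ^^ Suc l) (x n))"
    by (rule triangle[OF x_closed X(2,3)])
  also have "\<dots> \<le> e (n + l) + d (x (n + l)) ((S ^^ l) (x n))"
    using error[of "n + l"] nonexpansive[OF x_closed[of "n + l"] X(1)] by simp
  finally show ?case using Suc.IH by simp
qed

text \<open>The exact orbit restarted at time \<open>\<alpha> (\<eta> / 3)\<close> stays within \<open>\<eta> / 3\<close> of the inexact one, and
  \<open>Phi (\<eta> / 3)\<close> steps later its own steps are at most \<open>\<eta> / 3\<close>.\<close>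

lemma asymptotic_regularity:
  assumes mid: "\<And>u w. \<lbrakk>u \<in> X; w \<in> X\<rbrakk> \<Longrightarrow> 2 * d (S u) (S w) \<le> d u (S w) + d w (S u)"
    and u: "u \<in> Fix X S" and b: "d (x 0) u \<le> b"
    and B: "\<And>l. (\<Sum>i<l. e i) \<le> B"
    and alpha: "Cauchy_modulus e \<alpha>" and eta: "0 < \<eta>" and n: "Phi' \<alpha> b B \<eta> \<le> n"
  shows "d (x n) (S (x n)) \<le> \<eta>"
proof -
  define m where "m = \<alpha> (\<eta> / 3)"
  define q where "q = n - m"
  have nm: "n = m + q" and q: "Phi (\<eta> / 3) (2 * (b + B)) \<le> q"
    using n by (auto simp: Phi'_def m_def q_def)
  define w where "w = (S ^^ q) (x m)"
  have uX: "u \<in> X" and Su: "S u = u" using u by (auto simp: Fix_def)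
  have wX: "w \<in> X" "S w \<in> X" "S (x n) \<in> X"
    using funpow_closed x_closed S_closed by (auto simp: w_def)
  have "d (x m) u \<le> b + B"
    using quasi_Fejer[OF uX, of 0 m] b B[of m] uX Su by simp
  then have step: "d w (S w) \<le> \<eta> / 3"
    unfolding w_def using orbit_asymptotic_regularity[OF mid u x_closed _ _ q] eta by simp
  have "d (x n) w \<le> (\<Sum>i<q. e (m + i))"
    unfolding nm w_def by (rule distance_to_exact_orbit)
  also have "\<dots> \<le> \<eta> / 3"
    using Cauchy_modulus_tail[OF alpha error_nonneg, of "\<eta> / 3" m q] eta by (simp add: m_def)
  finally have close: "d (x n) w \<le> \<eta> / 3" .
  have "d (S w) (S (x n)) \<le> d (x n) w"
    using nonexpansive[OF wX(1) x_closed[of n]] by (simp add: commute)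
  then show ?thesis
    using close step triangle[OF x_closed[of n] wX(1,3)] triangle[OF wX(1,2,3)] by linarith
qed

section \<open>Metastability from total boundedness\<close>

text \<open>The times \<open>N 1 \<le> N 2 \<le> \<dots>\<close> are chosen so that \<open>x (N j)\<close> is a good enough approximate fixed
  point for every starting time \<open>N i\<close> with \<open>i < j\<close>: over \<open>g (N i)\<close> steps its defect contributes at
  most \<open>1 / (r + 1)\<close>, where \<open>r + 1 = 8 (k + 1)\<close>, as do the errors of the iteration after time
  \<open>\<alpha> (1 / (r + 1))\<close>. Two of these points, say \<open>x (N i)\<close> and \<open>x (N j)\<close>, are \<open>1 / (r + 1)\<close>-close, so
  \<open>x (N i), \<dots>, x (N i + g (N i))\<close> lie within \<open>3 / (r + 1)\<close> of \<open>x (N j)\<close>.\<close>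

lemma metastability_of_regular_sequence:
  fixes N \<phi> :: "nat \<Rightarrow> nat"
  assumes tb: "total_boundedness_modulus X d \<gamma>"
    and alpha: "Cauchy_modulus e \<alpha>"
    and reg: "\<And>i n. \<phi> i \<le> n \<Longrightarrow> d (x n) (S (x n)) \<le> 1 / (real i + 1)"
    and N0: "N 0 = 0"
    and N_Suc: "\<And>j. N (Suc j) = max (xi \<alpha> (8 * k + 7)) (Max (\<phi> ` {..chi_M g (N j) (8 * k + 7)}))"
  shows "\<exists>n\<le>N (\<gamma> (8 * k + 7) + 1). \<forall>i\<in>{n..n + g n}. \<forall>j\<in>{n..n + g n}.
           d (x i) (x j) \<le> 1 / (real k + 1)"
proof -
  define r where "r = 8 * k + 7"
  define \<eta> where "\<eta> = 1 / (real r + 1)"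
  have eta: "0 < \<eta>" by (simp add: \<eta>_def)
  have chi_mono: "chi_M g m r \<le> chi_M g n r" if "m \<le> n" for m n
    unfolding chi_M_def using that by (intro mult_le_mono1 Max_mono) auto
  have "N j \<le> N (Suc j)" for j
  proof (induction j)
    case (Suc j)
    have "Max (\<phi> ` {..chi_M g (N j) r}) \<le> Max (\<phi> ` {..chi_M g (N (Suc j)) r})"
      using chi_mono[OF Suc.IH] by (intro Max_mono) auto
    then show ?case
      using N_Suc[of j] N_Suc[of "Suc j"] unfolding r_def by (metis max.mono order_refl)
  qed (simp add: N0)
  then have N_mono: "i \<le> j \<Longrightarrow> N i \<le> N j" for i j by (rule lift_Suc_mono_le)
  obtain i j where ij: "i < j" "j \<le> \<gamma> r" and near: "d (x (N (Suc i))) (x (N (Suc j))) \<le> \<eta>"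
    using tb[unfolded total_boundedness_modulus_def, rule_format, of "\<lambda>n. x (N (Suc n))" r] x_closed
    by (auto simp: \<eta>_def)
  define n where "n = N (Suc i)"
  define p where "p = x (N (Suc j))"
  define h where "h = chi_M g n r"
  have pX: "p \<in> X" by (simp add: p_def x_closed)
  have "h \<le> chi_M g (N j) r"
    unfolding h_def n_def using ij by (intro chi_mono N_mono) simp
  then have "\<phi> h \<le> Max (\<phi> ` {..chi_M g (N j) r})" by (intro Max_ge) auto
  then have defect: "d p (S p) \<le> 1 / (real h + 1)"
    unfolding p_def by (intro reg) (simp add: N_Suc[of j] r_def)
  have close: "d (x m) p \<le> 3 * \<eta>" if m: "m \<in> {n..n + g n}" for m
  proof -
    define l where "l = m - n"
    have ml: "m = n + l" and l: "l \<le> g n" using m by (auto simp: l_def)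
    have "g n \<le> Max (g ` {..n})" by (intro Max_ge) auto
    then have "l \<le> Max (g ` {..n})" using l by linarith
    then have "l * (r + 1) \<le> h" unfolding h_def chi_M_def by (rule mult_le_mono1)
    then have "real l * (real r + 1) \<le> real h"
      by (metis of_nat_le_iff of_nat_mult of_nat_add of_nat_1)
    then have "real l * (1 / (real h + 1)) \<le> \<eta>"
      by (simp add: \<eta>_def field_simps)
    then have "real l * d p (S p) \<le> \<eta>"
      using mult_left_mono[OF defect, of "real l"] by simp
    moreover have "(\<Sum>i<l. e (n + i)) \<le> \<eta>"
      by (rule Cauchy_modulus_tail[OF alpha error_nonneg eta])
        (simp add: n_def N_Suc[of i] xi_def \<eta>_def r_def)
    ultimately show ?thesis
      using quasi_Fejer[OF pX, of n l] near by (simp add: ml n_def p_def)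
  qed
  have "d (x m) (x m') \<le> 1 / (real k + 1)" if "m \<in> {n..n + g n}" "m' \<in> {n..n + g n}" for m m'
  proof -
    have "d (x m) (x m') \<le> 6 * \<eta>"
      using triangle[OF x_closed[of m] pX x_closed[of m']] close[OF that(1)] close[OF that(2)]
      by (simp add: commute)
    also have "\<dots> \<le> 1 / (real k + 1)" by (simp add: \<eta>_def r_def field_simps)
    finally show ?thesis .
  qed
  moreover have "n \<le> N (\<gamma> r + 1)"
    unfolding n_def using ij by (intro N_mono) simp
  ultimately show ?thesis unfolding r_def by blast
qed

end

text \<open>For a sequence that is not Cauchy, there is some \<open>g\<close> such that every interval
  \<open>[n, n + g n]\<close> contains a pair of indices with distant values.\<close>

lemma (in Metric_space) metastable_imp_MCauchy:
  assumes x: "\<And>n. x n \<in> M" and meta: "metastability_rate d x \<Omega>"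
  shows "MCauchy x"
proof (rule ccontr)
  assume "\<not> MCauchy x"
  then obtain \<eta> where eta: "0 < \<eta>" and far: "\<And>n. \<exists>i j. n \<le> i \<and> n \<le> j \<and> \<eta> \<le> d (x i) (x j)"
    using x by (auto simp: MCauchy_def not_less)
  have "\<exists>l. \<exists>i\<in>{n..n + l}. \<exists>j\<in>{n..n + l}. \<eta> \<le> d (x i) (x j)" for n
  proof -
    obtain i j where "n \<le> i" "n \<le> j" "\<eta> \<le> d (x i) (x j)" using far by blast
    then show ?thesis by (intro exI[of _ "i + j"] bexI[of _ i] bexI[of _ j]) auto
  qed
  then obtain g where g: "\<And>n. \<exists>i\<in>{n..n + g n}. \<exists>j\<in>{n..n + g n}. \<eta> \<le> d (x i) (x j)"
    by metis
  obtain k where k: "1 / (real k + 1) < \<eta>"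
    using reals_Archimedean[OF eta] by (auto simp: inverse_eq_divide add.commute)
  obtain n where "\<forall>i\<in>{n..n + g n}. \<forall>j\<in>{n..n + g n}. d (x i) (x j) \<le> 1 / (real k + 1)"
    using meta unfolding metastability_rate_def by blast
  then show False using g[of n] k by force
qed

section \<open>The alternating iteration\<close>

theorem theorem4p5:
  fixes X :: "'a set" and d :: "'a \<Rightarrow> 'a \<Rightarrow> real"
    and \<gamma> :: "nat \<Rightarrow> nat"
    and T1 T2 :: "'a \<Rightarrow> 'a"
    and \<epsilon> \<delta> :: "nat \<Rightarrow> real"
    and x y :: "nat \<Rightarrow> 'a"
    and \<alpha> \<beta> :: "real \<Rightarrow> nat"
    and b B :: real
  assumes "CAT0_space X d"
    and "total_boundedness_modulus X d \<gamma>"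
    and "T1 \<in> X \<rightarrow> X" and "T2 \<in> X \<rightarrow> X"
    and "property_P2 X d T1" and "property_P2 X d T2"
    and "Fix X (T2 \<circ> T1) \<noteq> {}"
    and "\<And>n. 0 \<le> \<epsilon> n" and "\<And>n. 0 \<le> \<delta> n"
    and "summable \<epsilon>" and "summable \<delta>"
    and "\<And>n. x n \<in> X" and "\<And>n. y n \<in> X"
    and "\<And>n. d (y n) (T1 (x n)) \<le> \<epsilon> n"
    and "\<And>n. d (x (Suc n)) (T2 (y n)) \<le> \<delta> n"
    and "Cauchy_modulus (\<lambda>n. \<epsilon> n + \<delta> n) \<alpha>"
    and "null_convergence_rate (\<lambda>n. \<epsilon> n + \<delta> n) \<beta>"
    and "0 \<le> B" and "(\<Sum>n. \<epsilon> n + \<delta> n) \<le> B"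
    and "0 < b" and "\<exists>u\<in>Fix X (T2 \<circ> T1). d (x 0) u \<le> b"
  shows "(Metric_space.MCauchy X d x \<and>
          metastability_rate d x (\<lambda>k g. Psi k g \<gamma> \<alpha> \<beta> b B)) \<and>
         (\<forall>\<alpha>' \<beta>' :: real \<Rightarrow> nat.
           null_convergence_rate (\<lambda>n. \<epsilon> (Suc n) + \<delta> n) \<beta>' \<longrightarrow>
           Cauchy_modulus (\<lambda>n. \<epsilon> (Suc n) + \<delta> n) \<alpha>' \<longrightarrow>
           metastability_rate d y (\<lambda>k g. Psi' k g \<gamma> \<alpha> \<alpha>' \<beta>' b B))"
proof -
  interpret CAT0_space X d by fact
  note P2 = assms(5,6) and T1 = assms(3) and T2 = assms(4)
  note xX = assms(12) and yX = assms(13)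
  let ?S = "T2 \<circ> T1" and ?U = "T1 \<circ> T2"
  have T1x: "T1 (x n) \<in> X" and T2y: "T2 (y n) \<in> X"
    and Sx: "T2 (T1 (x n)) \<in> X" and Uy: "T1 (T2 (y n)) \<in> X"
    and USx: "T1 (T2 (T1 (x n))) \<in> X" for n
    using T1 T2 xX yX by blast+
  note ne1 = P2_nonexpansive[OF P2(1) T1] and ne2 = P2_nonexpansive[OF P2(2) T2]
  have err_x: "d (x (Suc n)) (T2 (T1 (x n))) \<le> \<epsilon> n + \<delta> n" for n
    using triangle[OF xX[of "Suc n"] T2y[of n] Sx[of n]] ne2[OF yX[of n] T1x[of n]]
      assms(14)[of n] assms(15)[of n] by linarith
  have err_y: "d (y (Suc n)) (T1 (T2 (y n))) \<le> \<epsilon> (Suc n) + \<delta> n" for n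
    using triangle[OF yX[of "Suc n"] T1x[of "Suc n"] Uy[of n]] ne1[OF xX[of "Suc n"] T2y[of n]]
      assms(14)[of "Suc n"] assms(15)[of n] by linarith
  interpret x: inexact_iteration X d ?S x "\<lambda>n. \<epsilon> n + \<delta> n"
  proof unfold_locales
    show "?S \<in> X \<rightarrow> X" using T1 T2 by auto
    show "d (?S u) (?S w) \<le> d u w" if "u \<in> X" "w \<in> X" for u w
      using ne1[OF that] ne2[of "T1 u" "T1 w"] T1 that by force
  qed (use xX err_x in auto)
  interpret y: inexact_iteration X d ?U y "\<lambda>n. \<epsilon> (Suc n) + \<delta> n"
  proof unfold_locales
    show "?U \<in> X \<rightarrow> X" using T1 T2 by auto
    show "d (?U u) (?U w) \<le> d u w" if "u \<in> X" "w \<in> X" for u w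
      using ne2[OF that] ne1[of "T2 u" "T2 w"] T2 that by force
  qed (use yX err_y in auto)
  obtain u where u: "u \<in> Fix X ?S" and b: "d (x 0) u \<le> b" using assms(21) by blast
  have sums: "(\<Sum>i<l. \<epsilon> i + \<delta> i) \<le> B" for l
    using sum_le_suminf[of "\<lambda>i. \<epsilon> i + \<delta> i" "{..<l}"] assms(8-11,19)
    by (force intro: summable_add)
  have reg_x: "d (x n) (?S (x n)) \<le> \<eta>" if "0 < \<eta>" "Phi' \<alpha> b B \<eta> \<le> n" for \<eta> n
    by (rule x.asymptotic_regularity[OF _ u b sums assms(16) that])
      (use P2_composition_midpoint[OF P2 T1 T2] in simp)
  \<comment> \<open>The time \<open>Phi'' \<alpha> b B \<eta>\<close> is at least \<open>\<alpha> (\<eta> / 6)\<close>; from there on \<open>\<epsilon> n \<le> \<eta> / 6\<close>.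
    Passing between \<open>y n\<close> and \<open>T1 (x n)\<close> twice costs \<open>2 \<epsilon> n\<close>, beside the defect of \<open>x n\<close>,
    which is at most \<open>\<eta> / 2\<close>.\<close>
  have reg_y: "d (y n) (?U (y n)) \<le> \<eta>" if eta: "0 < \<eta>" and n: "Phi'' \<alpha> b B \<eta> \<le> n" for \<eta> n
  proof -
    have defect: "d (x n) (T2 (T1 (x n))) \<le> \<eta> / 2"
      using reg_x[of "\<eta> / 2" n] eta n by (simp add: Phi''_def)
    have "\<alpha> (\<eta> / 6) \<le> n" using n by (simp add: Phi''_def Phi'_def)
    then have "\<epsilon> n + \<delta> n \<le> \<eta> / 6"
      using Cauchy_modulus_tail[OF assms(16) x.error_nonneg, of "\<eta> / 6" n 1] eta by simp
    then have small: "d (y n) (T1 (x n)) \<le> \<eta> / 6"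
      using assms(9)[of n] assms(14)[of n] by linarith
    have "d (y n) (T1 (T2 (y n)))
        \<le> d (y n) (T1 (x n)) + d (T1 (x n)) (T1 (T2 (T1 (x n))))
          + d (T1 (T2 (T1 (x n)))) (T1 (T2 (y n)))"
      using triangle[OF yX[of n] T1x[of n] Uy[of n]] triangle[OF T1x[of n] USx[of n] Uy[of n]]
      by linarith
    moreover have "d (T1 (x n)) (T1 (T2 (T1 (x n)))) \<le> d (x n) (T2 (T1 (x n)))"
      by (rule ne1[OF xX Sx])
    moreover have "d (T1 (T2 (T1 (x n)))) (T1 (T2 (y n))) \<le> d (y n) (T1 (x n))"
      using y.nonexpansive[OF T1x[of n] yX[of n]] by (simp add: commute)
    ultimately show ?thesis using small defect eta by simp
  qed
  have meta_x: "metastability_rate d x (\<lambda>k g. Psi k g \<gamma> \<alpha> \<beta> b B)"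
    unfolding metastability_rate_def Psi_def
  proof (intro allI x.metastability_of_regular_sequence[OF assms(2) assms(16)])
    fix i n
    assume "Phi_beta \<alpha> \<beta> b B (1 / (real i + 1)) \<le> n"
    then have "d (x n) (?S (x n)) \<le> 1 / (real i + 1) / 2"
      by (intro reg_x) (auto simp: Phi_beta_def)
    also have "\<dots> \<le> 1 / (real i + 1)" by (simp add: field_simps)
    finally show "d (x n) (?S (x n)) \<le> 1 / (real i + 1)" .
  qed (simp_all add: Phi_hat_def)
  have meta_y: "metastability_rate d y (\<lambda>k g. Psi' k g \<gamma> \<alpha> \<alpha>' \<beta>' b B)"
    if "Cauchy_modulus (\<lambda>n. \<epsilon> (Suc n) + \<delta> n) \<alpha>'" for \<alpha>' \<beta>'
    unfolding metastability_rate_def Psi'_def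
  proof (intro allI y.metastability_of_regular_sequence[OF assms(2) that])
    fix i n
    assume "Phi'_beta \<alpha> \<beta>' b B (1 / (real i + 1)) \<le> n"
    then have "d (y n) (?U (y n)) \<le> 1 / (real i + 1) / 2"
      by (intro reg_y) (auto simp: Phi'_beta_def)
    also have "\<dots> \<le> 1 / (real i + 1)" by (simp add: field_simps)
    finally show "d (y n) (?U (y n)) \<le> 1 / (real i + 1)" .
  qed (simp_all add: Phi'_hat_def)
  show ?thesis
    using metastable_imp_MCauchy[OF xX meta_x] meta_x meta_y by blast
qed

end
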